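(* Let $\mathbb{K}$ be a field of characteristic zero and let $d\geq 2$ be a prime power. Let ${\bf m}=(m_1,\ldots,m_{d-1})$ and ${\bf n}=(n_1,\ldots,n_{d-1})$ be $(d-1)$-tuples of integers with $0\leq m_i<n_i$ for $1\leq i\leq d-1$. Then the set $$V^{\bf m,n}=\left\{({\bf a},b)\in\mathbb{K}^{d-1}\times\mathbb{K}:\ \bar{\bf a}=0\ \text{ and }\ F_{{\bf a},b}^{m_i}(a_i)=F_{{\bf a},b}^{n_i}(a_i)\ \text{ for all } 1\leq i\leq d-1\right\}$$ is finite.
   Context: For ${\bf a}=(a_1,\ldots,a_{d-1})\in\mathbb{K}^{d-1}$ and $b\in\mathbb{K}$, let $\sigma_k$ be the $k$-th elementary symmetric function of $a_1,\ldots,a_{d-1}$, let $\bar{\bf a}=\frac{1}{d-1}\sum_{i=1}^{d-1}a_i$, and define $$F_{{\bf a},b}(z)=z^d+\sum_{k=1}^{d-1}(-1)^{d-k}\frac{d}{k}\sigma_{d-k}z^k+b-\bar{\bf a}^d-\sum_{k=1}^{d-1}(-1)^{d-k}\frac{d}{k}\sigma_{d-k}\bar{\bf a}^k .$$ This is the unique monic polynomial of degree $d$ whose critical points, listed with multiplicity, are $a_1,\ldots,a_{d-1}$ and which satisfies $F_{{\bf a},b}(\bar{\bf a})=b$. Iterates are defined by $F^0(z)=z$ and $F^{n+1}(z)=F(F^n(z))$. *)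

theory Defs
  imports "HOL-Number_Theory.Prime_Powers" "HOL-Library.FuncSet"
begin

text \<open>
  A tuple in \<open>K\<^sup>d\<^sup>-\<^sup>1\<close> is a function on the index set \<open>{1..d-1}\<close>; the argument \<open>d\<close> of the
  definitions below is the degree, so there are \<open>d - 1\<close> variables.
\<close>

definition elem_sym :: "nat \<Rightarrow> (nat \<Rightarrow> 'a::comm_ring_1) \<Rightarrow> nat \<Rightarrow> 'a" where
  "elem_sym d a k = (\<Sum>X \<in> {X. X \<subseteq> {1..d-1} \<and> card X = k}. \<Prod>i\<in>X. a i)"

definition tuple_mean :: "nat \<Rightarrow> (nat \<Rightarrow> 'a::field_char_0) \<Rightarrow> 'a" where
  "tuple_mean d a = (1 / of_nat (d - 1)) * (\<Sum>i=1..d-1. a i)"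

text \<open>
  The monic polynomial map of degree \<open>d\<close> with derivative \<open>d * (\<Prod>i=1..d-1. z - a i)\<close> and
  with value \<open>b\<close> at the mean of the \<open>a i\<close>.
\<close>

definition F_map :: "nat \<Rightarrow> (nat \<Rightarrow> 'a::field_char_0) \<Rightarrow> 'a \<Rightarrow> 'a \<Rightarrow> 'a" where
  "F_map d a b z =
     z ^ d + (\<Sum>k=1..d-1. (-1) ^ (d - k) * (of_nat d / of_nat k) * elem_sym d a (d - k) * z ^ k)
     + b - tuple_mean d a ^ d
     - (\<Sum>k=1..d-1. (-1) ^ (d - k) * (of_nat d / of_nat k) * elem_sym d a (d - k) * tuple_mean d a ^ k)"

text \<open>
  Tuples are taken in the extensional function space \<open>{1..d-1} \<rightarrow>\<^sub>E UNIV\<close>, so that each point of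
  \<open>K\<^sup>d\<^sup>-\<^sup>1\<close> is represented by exactly one function; otherwise finiteness would fail because of
  the irrelevant values outside the index set.
\<close>

definition V_set :: "nat \<Rightarrow> (nat \<Rightarrow> nat) \<Rightarrow> (nat \<Rightarrow> nat) \<Rightarrow> ((nat \<Rightarrow> 'a::field_char_0) \<times> 'a) set" where
  "V_set d m n =
     {(a, b). a \<in> {1..d-1} \<rightarrow>\<^sub>E UNIV \<and> tuple_mean d a = 0 \<and>
        (\<forall>i\<in>{1..d-1}. (F_map d a b ^^ m i) (a i) = (F_map d a b ^^ n i) (a i))}"

end

theory Submission
  imports Defs "HOL-Library.Function_Algebras" "HOL-Computational_Algebra.Polynomial"
begin

text \<open>
  Let \<open>d = p ^ e\<close>. The equations defining the set have no solution at infinity, already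
  modulo \<open>p\<close>. Give each critical point \<open>a\<^sub>i\<close> weight 1 and \<open>b\<close> weight \<open>d\<close>. For a centered tuple,
  \<open>F(z) = z ^ d + \<Sum> \<plusminus> (d / k) \<sigma>\<^bsub>d-k\<^esub> z ^ k + b\<close>, and each \<open>d / k\<close> with \<open>0 < k < d\<close> is \<open>p\<close> times a
  \<open>p\<close>-integral number. Modulo \<open>p\<close> and terms of lower weight, \<open>F\<^sup>n(a\<^sub>i)\<close> is therefore
  \<open>(a\<^sub>i ^ d + b) ^ (d ^ (n - 1))\<close> (\<open>iterate_diff\<close>), while \<open>F\<^sup>m(a\<^sub>i)\<close> with \<open>m < n\<close> has lower weight. So the orbit
  relations force \<open>a\<^sub>i ^ d = - b\<close> at infinity, modulo \<open>p\<close>. Frobenius is injective, hence all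
  \<open>a\<^sub>i\<close> agree; they sum to zero and there are \<open>d - 1 \<equiv> -1\<close> of them, so they are zero
  and \<open>b\<close> is zero (\<open>generator_powers_negligible\<close>).

  Absence of solutions at infinity becomes finiteness as follows. The coordinates are viewed as
  functions on the solution set, and polynomials in them are filtered by weight. A monomial of large
  weight contains a high power of some coordinate, so it is \<open>p\<close> times a \<open>p\<close>-integral combination of
  monomials of the same weight, plus lower terms. There are finitely many
  monomials of each weight and \<open>p\<close> is in the Jacobson radical of the \<open>p\<close>-integral
  rationals, so Nakayama's lemma removes the first part: the monomial is a combination of lower
  ones (\<open>filt_stable\<close>). Thus polynomial functions on the solution set form a finitely generated
  module, the powers of each coordinate are linearly dependent over the field, and each coordinate takes
  finitely many values (\<open>finite_range_if_powers_span_finite\<close>).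

  The ring of functions on the solution set takes the place of a polynomial ring modulo an
  ideal: in it the orbit relations hold as identities.
\<close>

section \<open>Nakayama's lemma over a ring with \<open>p\<close> in its Jacobson radical\<close>

text \<open>
  The assumption \<open>unit_ex\<close> says that \<open>p\<close> lies in the Jacobson radical of the subring \<open>A\<close>. The
  example to keep in mind is the localization of the integers at \<open>p\<close>, embedded as constant
  functions.
\<close>

locale coefficient_ring =
  fixes A :: "'r::comm_ring_1 set" and p :: nat
  assumes prime_p: "prime p"
    and one_in [simp, intro]: "1 \<in> A"
    and add_in [intro]: "a \<in> A \<Longrightarrow> b \<in> A \<Longrightarrow> a + b \<in> A"
    and minus_in [intro]: "a \<in> A \<Longrightarrow> - a \<in> A"
    and mult_in [intro]: "a \<in> A \<Longrightarrow> b \<in> A \<Longrightarrow> a * b \<in> A"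
    and unit_ex: "c \<in> A \<Longrightarrow> \<exists>u\<in>A. u * (1 - of_nat p * c) = 1"
begin

lemma zero_in [simp, intro]: "0 \<in> A"
  using add_in[OF one_in minus_in[OF one_in]] by simp

lemma of_nat_in [simp, intro]: "of_nat n \<in> A"
  by (induction n) auto

text \<open>
  Nakayama's lemma: if \<open>span U\<close> is contained in \<open>p * span U + W\<close>, then it is contained in \<open>W\<close>.
  The generators are eliminated one at a time: the coefficient \<open>1 - p * c\<close> of \<open>u\<close> in its own
  equation is a unit, so \<open>u\<close> can be solved for and substituted into the remaining equations,
  which keep their shape.
\<close>

lemma nakayama:
  fixes U W :: "'r set"
  assumes "finite U"
    and add: "\<And>y z. y \<in> W \<Longrightarrow> z \<in> W \<Longrightarrow> y + z \<in> W"
    and scale: "\<And>a y. a \<in> A \<Longrightarrow> y \<in> W \<Longrightarrow> a * y \<in> W"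
    and "\<And>u. u \<in> U \<Longrightarrow> \<exists>c w. (\<forall>v\<in>U. c v \<in> A) \<and> w \<in> W \<and> u = of_nat p * (\<Sum>v\<in>U. c v * v) + w"
  shows "U \<subseteq> W"
  using assms(1,4)
proof (induction U rule: finite_induct)
  case empty
  then show ?case by simp
next
  case (insert u U)
  obtain c w where c: "\<forall>v\<in>insert u U. c v \<in> A" and w: "w \<in> W"
    and u: "u = of_nat p * (\<Sum>v\<in>insert u U. c v * v) + w"
    using insert.prems[of u] by blast
  obtain r where r: "r \<in> A" "r * (1 - of_nat p * c u) = 1"
    using unit_ex[of "c u"] c by auto
  define S where "S = (\<Sum>v\<in>U. c v * v)"
  have "(1 - of_nat p * c u) * u = of_nat p * S + w"
    using u insert.hyps by (simp add: S_def algebra_simps)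
  then have "r * ((1 - of_nat p * c u) * u) = r * (of_nat p * S + w)"
    by simp
  moreover have "r * ((1 - of_nat p * c u) * u) = u"
    using r(2) by (simp add: mult.assoc[symmetric])
  ultimately have u': "u = of_nat p * (r * S) + r * w"
    by (simp add: algebra_simps)
  have "U \<subseteq> W"
  proof (rule insert.IH)
    fix v assume "v \<in> U"
    then obtain c' w' where c': "\<forall>v\<in>insert u U. c' v \<in> A" and w': "w' \<in> W"
      and v: "v = of_nat p * (\<Sum>v\<in>insert u U. c' v * v) + w'"
      using insert.prems[of v] by blast
    define S' where "S' = (\<Sum>v\<in>U. c' v * v)"
    have "v = of_nat p * (c' u * u + S') + w'"
      using v insert.hyps by (simp add: S'_def)
    also have "\<dots> = of_nat p * (S' + (of_nat p * c' u * r) * S) + (of_nat p * c' u * r * w + w')"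
      by (subst u') (simp add: algebra_simps)
    also have "S' + (of_nat p * c' u * r) * S = (\<Sum>v\<in>U. (c' v + of_nat p * c' u * r * c v) * v)"
      by (simp add: S'_def S_def sum_distrib_left sum.distrib algebra_simps)
    finally have "v = of_nat p * (\<Sum>v\<in>U. (c' v + of_nat p * c' u * r * c v) * v)
        + (of_nat p * c' u * r * w + w')" .
    moreover have "\<forall>v\<in>U. c' v + of_nat p * c' u * r * c v \<in> A"
      using c c' r by (intro ballI add_in mult_in of_nat_in) auto
    moreover have "of_nat p * c' u * r * w + w' \<in> W"
      using c' r w w' by (intro add scale) auto
    ultimately show "\<exists>c w. (\<forall>v\<in>U. c v \<in> A) \<and> w \<in> W \<and> v = of_nat p * (\<Sum>v\<in>U. c v * v) + w"
      by (intro exI conjI)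
  qed
  moreover have "T \<subseteq> U \<Longrightarrow> (\<Sum>v\<in>T. c v * v) \<in> W" if "finite T" for T
    using that
  proof (induction T rule: finite_induct)
    case empty
    then show ?case using scale[of 0 w] w by simp
  next
    case (insert v T)
    with c \<open>U \<subseteq> W\<close> show ?case by (auto intro!: add scale)
  qed
  ultimately have "S \<in> W"
    using insert.hyps(1) unfolding S_def by blast
  then have "u \<in> W"
    by (subst u') (use r w in \<open>auto intro!: add scale\<close>)
  with \<open>U \<subseteq> W\<close> show ?case by simp
qed

end

section \<open>The weight filtration and its leading forms modulo \<open>p\<close>\<close>

lemma prime_dvd_choose_prime_power:
  fixes p :: nat
  assumes "prime p" "0 < j" "j < p ^ k"
  shows "p dvd (p ^ k choose j)"
proof -
  have k: "k > 0" using assms by (cases k) auto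
  have "p ^ k dvd j * (p ^ k choose j)"
    using assms times_binomial_minus1_eq[of j "p ^ k"] by simp
  show ?thesis
  proof (rule ccontr)
    assume "\<not> p dvd (p ^ k choose j)"
    then have "coprime (p ^ k) (p ^ k choose j)"
      using assms(1) by (simp add: prime_imp_coprime)
    then have "p ^ k dvd j"
      using \<open>p ^ k dvd j * (p ^ k choose j)\<close> coprime_dvd_mult_left_iff by blast
    with assms show False by (auto dest: dvd_imp_le)
  qed
qed

locale weighted_generators = coefficient_ring A p
  for A :: "'r::comm_ring_1 set" and p +
  fixes I :: "'i set" and x :: "'i \<Rightarrow> 'r" and w :: "'i \<Rightarrow> nat"
  assumes finite_I: "finite I"
    and weight_pos: "i \<in> I \<Longrightarrow> 0 < w i"
begin

definition monomial :: "('i \<Rightarrow> nat) \<Rightarrow> 'r" where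
  "monomial e = (\<Prod>i\<in>I. x i ^ e i)"

definition weight :: "('i \<Rightarrow> nat) \<Rightarrow> nat" where
  "weight e = (\<Sum>i\<in>I. w i * e i)"

text \<open>
  The span over \<open>A\<close> of the monomials of weight strictly below \<open>N\<close>. The strict bound makes
  \<open>filt 0\<close> the zero module; elements of weight at most \<open>N\<close> form \<open>filt (Suc N)\<close>.
\<close>

inductive_set filt :: "nat \<Rightarrow> 'r set" for N where
  filt_zero [simp, intro]: "0 \<in> filt N"
| filt_step: "y \<in> filt N \<Longrightarrow> c \<in> A \<Longrightarrow> weight e < N \<Longrightarrow> y + c * monomial e \<in> filt N"

lemma filt_add [intro]: "z \<in> filt N \<Longrightarrow> y \<in> filt N \<Longrightarrow> y + z \<in> filt N"
proof (induction z rule: filt.induct)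
  case (filt_step z c e)
  then show ?case using filt.filt_step[of "y + z"] by (simp add: add.assoc)
qed simp

lemma filt_scale [intro]: "y \<in> filt N \<Longrightarrow> a \<in> A \<Longrightarrow> a * y \<in> filt N"
proof (induction y rule: filt.induct)
  case (filt_step y c e)
  then show ?case using filt.filt_step[of "a * y" N "a * c" e] by (auto simp: algebra_simps)
qed simp

lemma filt_mono: "y \<in> filt M \<Longrightarrow> M \<le> N \<Longrightarrow> y \<in> filt N"
  by (induction y rule: filt.induct) (auto intro: filt_step)

lemma monomial_in_filt: "weight e < N \<Longrightarrow> monomial e \<in> filt N"
  using filt_step[of 0 N 1 e] by simp

lemma filt_sum [intro]: "(\<And>i. i \<in> S \<Longrightarrow> f i \<in> filt N) \<Longrightarrow> sum f S \<in> filt N"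
  by (induction S rule: infinite_finite_induct) auto

lemma monomial_mult: "monomial e * monomial f = monomial (\<lambda>i. e i + f i)"
  by (simp add: monomial_def power_add prod.distrib)

lemma weight_add: "weight (\<lambda>i. e i + f i) = weight e + weight f"
  by (simp add: weight_def sum.distrib algebra_simps)

lemma monomial_mult_filt: "z \<in> filt n \<Longrightarrow> monomial e * z \<in> filt (weight e + n)"
proof (induction z rule: filt.induct)
  case (filt_step z c f)
  then show ?case
    using filt.filt_step[of "monomial e * z" "weight e + n" c "\<lambda>i. e i + f i"]
    by (simp add: monomial_mult[symmetric] weight_add algebra_simps)
qed simp

lemma filt_mult: "y \<in> filt (Suc m) \<Longrightarrow> z \<in> filt n \<Longrightarrow> y * z \<in> filt (m + n)"
proof (induction y rule: filt.induct)
  case (filt_step y c e)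
  have "monomial e * z \<in> filt (m + n)"
    by (rule filt_mono[OF monomial_mult_filt]) (use filt_step in auto)
  then have "y * z + c * (monomial e * z) \<in> filt (m + n)"
    using filt_step by blast
  then show ?case by (simp add: algebra_simps)
qed simp

lemma filt_mult_Suc: "y \<in> filt (Suc m) \<Longrightarrow> z \<in> filt (Suc n) \<Longrightarrow> y * z \<in> filt (Suc (m + n))"
  using filt_mult[of y m z "Suc n"] by simp

lemma one_in_filt: "1 \<in> filt (Suc N)"
  using monomial_in_filt[of "\<lambda>_. 0" "Suc N"] by (simp add: monomial_def weight_def)

lemma filt_power: "y \<in> filt (Suc m) \<Longrightarrow> y ^ k \<in> filt (Suc (k * m))"
  by (induction k) (auto simp: one_in_filt intro: filt_mult_Suc)

lemma filt_prod:
  "finite S \<Longrightarrow> (\<And>i. i \<in> S \<Longrightarrow> f i \<in> filt (Suc (n i))) \<Longrightarrow> prod f S \<in> filt (Suc (\<Sum>i\<in>S. n i))"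
  by (induction S rule: finite_induct) (auto simp: one_in_filt intro: filt_mult_Suc)

lemma generator_in_filt:
  assumes "i \<in> I"
  shows "x i \<in> filt (Suc (w i))"
proof -
  have "monomial (\<lambda>j. if j = i then 1 else 0) = x i"
    using assms finite_I by (simp add: monomial_def if_distrib[where f="\<lambda>k. _ ^ k"] prod.delta cong: if_cong)
  moreover have "weight (\<lambda>j. if j = i then 1 else 0) = w i"
    using assms finite_I by (simp add: weight_def if_distrib[where f="\<lambda>k. _ * k"] sum.delta cong: if_cong)
  ultimately show ?thesis
    using monomial_in_filt[of "\<lambda>j. if j = i then 1 else 0" "Suc (w i)"] by simp
qed

text \<open>
  Elements of weight at most \<open>N\<close> that are, up to terms of lower weight, divisible by \<open>p\<close>. If the
  generators were independent, these would be the elements whose form of weight \<open>N\<close> vanishes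
  modulo \<open>p\<close>, so a congruence modulo \<open>negligible N\<close> is an equation between leading forms in
  characteristic \<open>p\<close>.
\<close>

definition negligible :: "nat \<Rightarrow> 'r set" where
  "negligible N = {of_nat p * y + z | y z. y \<in> filt (Suc N) \<and> z \<in> filt N}"

lemma negligibleI: "y \<in> filt (Suc N) \<Longrightarrow> z \<in> filt N \<Longrightarrow> of_nat p * y + z \<in> negligible N"
  unfolding negligible_def by blast

lemma p_in_negligible: "y \<in> filt (Suc N) \<Longrightarrow> of_nat p * y \<in> negligible N"
  using negligibleI[of y N 0] by simp

lemma filt_in_negligible: "z \<in> filt N \<Longrightarrow> z \<in> negligible N"
  using negligibleI[of 0 N z] by simp

lemma negligible_imp_filt: "y \<in> negligible N \<Longrightarrow> y \<in> filt (Suc N)"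
  unfolding negligible_def by (auto intro!: filt_add filt_scale elim: filt_mono)

lemma negligible_add [intro]: 
  assumes "y \<in> negligible N" "z \<in> negligible N"
  shows "y + z \<in> negligible N"
proof -
  obtain a b c d where *: "y = of_nat p * a + b" "z = of_nat p * c + d"
    "a \<in> filt (Suc N)" "c \<in> filt (Suc N)" "b \<in> filt N" "d \<in> filt N"
    using assms unfolding negligible_def by blast
  have "y + z = of_nat p * (a + c) + (b + d)"
    by (simp add: * algebra_simps)
  moreover have "of_nat p * (a + c) + (b + d) \<in> negligible N"
    by (intro negligibleI filt_add *)
  ultimately show ?thesis by simp
qed

lemma negligible_mult:
  assumes "y \<in> negligible m" "z \<in> filt (Suc n)"
  shows "y * z \<in> negligible (m + n)"
proof -
  obtain a b where *: "y = of_nat p * a + b" "a \<in> filt (Suc m)" "b \<in> filt m"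
    using assms unfolding negligible_def by blast
  then have "y * z = of_nat p * (a * z) + z * b"
    by (simp add: algebra_simps)
  moreover have "z * b \<in> filt (m + n)"
    using filt_mult[OF assms(2) *(3)] by (simp add: add.commute)
  ultimately show ?thesis
    using * assms by (auto intro!: negligibleI intro: filt_mult_Suc)
qed

lemma negligible_scale: "a \<in> A \<Longrightarrow> y \<in> negligible N \<Longrightarrow> a * y \<in> negligible N"
  using negligible_mult[of y N a 0] filt_scale[OF one_in_filt, of a 0] by (simp add: mult.commute)

lemma negligible_minus [intro]: "y \<in> negligible N \<Longrightarrow> - y \<in> negligible N"
  using negligible_scale[of "-1" y] by auto

lemma negligible_diff [intro]: "y \<in> negligible N \<Longrightarrow> z \<in> negligible N \<Longrightarrow> y - z \<in> negligible N"
  using negligible_add[of y N "- z"] by auto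

lemma negligible_zero [simp, intro]: "0 \<in> negligible N"
  by (simp add: filt_in_negligible)

lemma negligible_sum [intro]: "(\<And>i. i \<in> S \<Longrightarrow> f i \<in> negligible N) \<Longrightarrow> sum f S \<in> negligible N"
  by (induction S rule: infinite_finite_induct) auto

lemma negligible_power:
  assumes "y \<in> negligible m" "0 < k"
  shows "y ^ k \<in> negligible (k * m)"
proof -
  obtain j where "k = Suc j" using assms(2) by (cases k) auto
  then show ?thesis
    using negligible_mult[OF assms(1) filt_power[OF negligible_imp_filt[OF assms(1)], of j]] by simp
qed

lemma negligible_power_diff:
  assumes "y \<in> filt (Suc m)" "z \<in> filt (Suc m)" "y - z \<in> negligible m"
  shows "y ^ k - z ^ k \<in> negligible (k * m)"
proof (induction k)
  case (Suc k)
  have "y ^ Suc k - z ^ Suc k = (y - z) * y ^ k + (y ^ k - z ^ k) * z"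
    by (simp add: algebra_simps)
  moreover have "(y - z) * y ^ k \<in> negligible (m + k * m)"
    by (intro negligible_mult filt_power assms)
  moreover have "(y ^ k - z ^ k) * z \<in> negligible (k * m + m)"
    by (intro negligible_mult Suc assms)
  ultimately show ?case by (auto simp: add.commute)
qed simp

text \<open>
  Leading forms live in characteristic \<open>p\<close>, so raising to the power \<open>p ^ k\<close> is additive on them:
  the mixed binomial coefficients are divisible by \<open>p\<close>.
\<close>

lemma frobenius_add:
  assumes "y \<in> filt (Suc m)" "z \<in> filt (Suc m)"
  shows "(y + z) ^ (p ^ k) - (y ^ (p ^ k) + z ^ (p ^ k)) \<in> negligible (p ^ k * m)"
proof -
  define q where "q = p ^ k"
  have q: "q > 0" using prime_p by (simp add: q_def prime_gt_0_nat)
  have "{..q} = insert 0 (insert q {0<..<q})" using q by auto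
  then have "(y + z) ^ q = z ^ q + (y ^ q + (\<Sum>j\<in>{0<..<q}. of_nat (q choose j) * y ^ j * z ^ (q - j)))"
    using q by (simp add: binomial_ring)
  moreover have "(\<Sum>j\<in>{0<..<q}. of_nat (q choose j) * y ^ j * z ^ (q - j)) \<in> negligible (q * m)"
  proof (rule negligible_sum)
    fix j assume j: "j \<in> {0<..<q}"
    then have "p dvd (q choose j)"
      unfolding q_def by (intro prime_dvd_choose_prime_power prime_p) auto
    then obtain r where r: "q choose j = p * r" by blast
    have "y ^ j * z ^ (q - j) \<in> filt (Suc (j * m + (q - j) * m))"
      by (intro filt_mult_Suc filt_power assms)
    also have "j * m + (q - j) * m = q * m"
      using j by (simp add: add_mult_distrib[symmetric])
    finally have "of_nat p * (of_nat r * (y ^ j * z ^ (q - j))) \<in> negligible (q * m)"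
      by (intro p_in_negligible filt_scale[OF _ of_nat_in])
    then show "of_nat (q choose j) * y ^ j * z ^ (q - j) \<in> negligible (q * m)"
      by (simp add: r algebra_simps)
  qed
  ultimately show ?thesis by (simp add: q_def[symmetric])
qed

lemma frobenius_sum:
  assumes "finite S" "\<And>i. i \<in> S \<Longrightarrow> f i \<in> filt (Suc m)"
  shows "(\<Sum>i\<in>S. f i) ^ (p ^ k) - (\<Sum>i\<in>S. f i ^ (p ^ k)) \<in> negligible (p ^ k * m)"
  using assms
proof (induction S rule: finite_induct)
  case empty
  have "p \<noteq> 0" using prime_p by auto
  then show ?case by (simp add: power_0_left)
next
  case (insert j S)
  have "(f j + sum f S) ^ (p ^ k) - (f j ^ (p ^ k) + sum f S ^ (p ^ k)) \<in> negligible (p ^ k * m)"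
    by (intro frobenius_add filt_sum insert.prems) auto
  moreover have "sum f S ^ (p ^ k) - (\<Sum>i\<in>S. f i ^ (p ^ k)) \<in> negligible (p ^ k * m)"
    by (rule insert.IH) (simp add: insert.prems)
  ultimately have "((f j + sum f S) ^ (p ^ k) - (f j ^ (p ^ k) + sum f S ^ (p ^ k)))
      + (sum f S ^ (p ^ k) - (\<Sum>i\<in>S. f i ^ (p ^ k))) \<in> negligible (p ^ k * m)"
    by (rule negligible_add)
  with insert.hyps show ?case by (simp add: algebra_simps)
qed

definition monomials :: "nat \<Rightarrow> nat \<Rightarrow> 'r set" where
  "monomials M N = {monomial e | e. M \<le> weight e \<and> weight e < N}"

lemma finite_monomials: "finite (monomials M N)"
proof -
  have "monomials M N \<subseteq> monomial ` (I \<rightarrow>\<^sub>E {..N})"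
    unfolding monomials_def
  proof safe
    fix e assume e: "weight e < N"
    have "e i \<le> N" if "i \<in> I" for i
    proof -
      have "e i \<le> w i * e i" using weight_pos[OF that] by simp
      also have "\<dots> \<le> weight e"
        unfolding weight_def by (rule member_le_sum) (use that finite_I in auto)
      finally show ?thesis using e by simp
    qed
    then have "restrict e I \<in> I \<rightarrow>\<^sub>E {..N}" by auto
    moreover have "monomial e = monomial (restrict e I)"
      by (simp add: monomial_def)
    ultimately show "monomial e \<in> monomial ` (I \<rightarrow>\<^sub>E {..N})" by blast
  qed
  then show ?thesis
    by (rule finite_subset) (intro finite_imageI finite_PiE finite_I finite_atMost)
qed

text \<open>
  Splits an element into its terms of weight at least \<open>M\<close> and the rest. With \<open>N = Suc M\<close> this
  isolates the leading form; with \<open>M = 0\<close> it exhibits \<open>filt N\<close> as finitely generated.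
\<close>

lemma filt_decompose:
  assumes "y \<in> filt N"
  shows "\<exists>c z. (\<forall>v\<in>monomials M N. c v \<in> A) \<and> z \<in> filt M \<and> y = (\<Sum>v\<in>monomials M N. c v * v) + z"
  using assms
proof (induction y rule: filt.induct)
  case filt_zero
  show ?case by (rule exI[of _ "\<lambda>_. 0"], rule exI[of _ 0]) auto
next
  case (filt_step y c e)
  let ?U = "monomials M N"
  obtain c' z where IH: "\<forall>v\<in>?U. c' v \<in> A" "z \<in> filt M" "y = (\<Sum>v\<in>?U. c' v * v) + z"
    using filt_step.IH by blast
  show ?case
  proof (cases "M \<le> weight e")
    case False
    then have "c * monomial e \<in> filt M"
      using filt_step by (intro filt_scale monomial_in_filt) auto
    then have "z + c * monomial e \<in> filt M"
      using IH(2) by (intro filt_add)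
    moreover have "y + c * monomial e = (\<Sum>v\<in>?U. c' v * v) + (z + c * monomial e)"
      using IH(3) by (simp add: add.assoc)
    ultimately show ?thesis using IH(1) by blast
  next
    case True
    then have e: "monomial e \<in> ?U" using filt_step.hyps unfolding monomials_def by blast
    let ?c = "c'(monomial e := c' (monomial e) + c)"
    have "(\<Sum>v\<in>?U. ?c v * v) = (\<Sum>v\<in>?U. c' v * v + (if v = monomial e then c * v else 0))"
      by (rule sum.cong) (auto simp: algebra_simps)
    also have "\<dots> = (\<Sum>v\<in>?U. c' v * v) + c * monomial e"
      using finite_monomials e by (simp add: sum.distrib sum.delta)
    finally have "y + c * monomial e = (\<Sum>v\<in>?U. ?c v * v) + z"
      using IH(3) by (simp add: algebra_simps)
    moreover have "\<forall>v\<in>?U. ?c v \<in> A" using IH(1) e filt_step.hyps by auto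
    ultimately show ?thesis using IH(2) by blast
  qed
qed

text \<open>
  If some power of every generator is negligible, the filtration stabilizes. A monomial of weight
  above the sum of the weights of these powers is divisible by one of them, hence it
  is itself negligible: it equals \<open>p\<close> times a combination of monomials of the same weight, plus
  lower terms. Nakayama's lemma then expresses it by lower terms alone.
\<close>

lemma filt_stable:
  assumes "\<And>i. i \<in> I \<Longrightarrow> x i ^ K i \<in> negligible (w i * K i)"
    and "y \<in> filt N"
  shows "y \<in> filt (Suc (\<Sum>i\<in>I. w i * K i))"
proof -
  have step: "filt (Suc N) \<subseteq> filt N" if N: "N > (\<Sum>i\<in>I. w i * K i)" for N
  proof -
    let ?U = "monomials N (Suc N)"
    have "?U \<subseteq> filt N"
    proof (rule nakayama)
      show "finite ?U"
        by (rule finite_monomials)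
    next
      fix u assume "u \<in> ?U"
      then obtain e where e: "u = monomial e" "weight e = N"
        unfolding monomials_def by auto
      have "\<exists>i\<in>I. K i \<le> e i"
      proof (rule ccontr)
        assume "\<not> ?thesis"
        then have "weight e \<le> (\<Sum>i\<in>I. w i * K i)"
          unfolding weight_def by (intro sum_mono mult_left_mono) auto
        with e N show False by simp
      qed
      then obtain i where i: "i \<in> I" "K i \<le> e i" by blast
      define f where "f = e(i := e i - K i)"
      have "u = (x i ^ e i) * (\<Prod>j\<in>I - {i}. x j ^ e j)"
        unfolding e monomial_def using i finite_I by (simp add: prod.remove)
      also have "x i ^ e i = x i ^ K i * x i ^ f i"
        using i by (simp add: f_def power_add[symmetric])
      also have "(\<Prod>j\<in>I - {i}. x j ^ e j) = (\<Prod>j\<in>I - {i}. x j ^ f j)"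
        by (rule prod.cong) (auto simp: f_def)
      finally have u: "u = x i ^ K i * monomial f"
        unfolding monomial_def using i finite_I by (simp add: prod.remove algebra_simps)
      have "weight e = w i * e i + (\<Sum>j\<in>I - {i}. w j * e j)"
        unfolding weight_def using i finite_I by (simp add: sum.remove)
      also have "w i * e i = w i * K i + w i * f i"
        using i by (simp add: f_def add_mult_distrib2[symmetric])
      also have "(\<Sum>j\<in>I - {i}. w j * e j) = (\<Sum>j\<in>I - {i}. w j * f j)"
        by (rule sum.cong) (auto simp: f_def)
      finally have "N = w i * K i + weight f"
        unfolding weight_def e(2)[unfolded weight_def] using i finite_I by (simp add: sum.remove)
      then have "u \<in> negligible N"
        using negligible_mult[OF assms(1)[OF i(1)] monomial_in_filt[of f "Suc (weight f)"]] u by simp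
      then obtain y z where yz: "u = of_nat p * y + z" "y \<in> filt (Suc N)" "z \<in> filt N"
        unfolding negligible_def by blast
      obtain c z' where c: "\<forall>v\<in>?U. c v \<in> A" "z' \<in> filt N" "y = (\<Sum>v\<in>?U. c v * v) + z'"
        using filt_decompose[OF yz(2), of N] by blast
      have "u = of_nat p * (\<Sum>v\<in>?U. c v * v) + (of_nat p * z' + z)"
        using yz c by (simp add: algebra_simps)
      moreover have "of_nat p * z' + z \<in> filt N" using yz c by auto
      ultimately show "\<exists>c w. (\<forall>v\<in>?U. c v \<in> A) \<and> w \<in> filt N \<and> u = of_nat p * (\<Sum>v\<in>?U. c v * v) + w"
        using c(1) by blast
    qed auto
    moreover have "y \<in> filt N" if "y \<in> filt (Suc N)" "?U \<subseteq> filt N" for y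
      using that
    proof (induction y rule: filt.induct)
      case (filt_step y c e)
      have "monomial e \<in> filt N"
      proof (cases "weight e = N")
        case True
        then have "monomial e \<in> ?U" unfolding monomials_def by auto
        then show ?thesis using filt_step.prems by blast
      next
        case False
        then show ?thesis using filt_step by (intro monomial_in_filt) auto
      qed
      with filt_step show ?case by blast
    qed simp
    ultimately show ?thesis by blast
  qed
  have "filt (Suc (\<Sum>i\<in>I. w i * K i) + k) \<subseteq> filt (Suc (\<Sum>i\<in>I. w i * K i))" for k
  proof (induction k)
    case (Suc k)
    show ?case using step[of "Suc (\<Sum>i\<in>I. w i * K i) + k"] Suc by auto
  qed simp
  moreover have "y \<in> filt (Suc (\<Sum>i\<in>I. w i * K i) + N)"
    using assms(2) by (rule filt_mono) simp
  ultimately show ?thesis by blast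
qed

end

section \<open>Critical orbit relations for degree \<open>p ^ e\<close>\<close>

text \<open>
  The generators are the critical points \<open>x 1, \<dots>, x (d - 1)\<close>, of weight 1, and the constant term
  \<open>x 0\<close>, of weight \<open>d\<close>; with these weights the polynomial map of a centered tuple is homogeneous of
  degree \<open>d\<close>. The factor \<open>g k\<close> stands for \<open>\<plusminus> d / (k * p)\<close>, which is \<open>p\<close>-integral because \<open>k\<close> is
  less than the power \<open>d\<close> of \<open>p\<close>.
\<close>

locale critical_orbit_system =
  weighted_generators A p "{..<d}" x "\<lambda>i. if i = 0 then d else 1"
  for A :: "'r::comm_ring_1 set" and p d :: nat and x :: "nat \<Rightarrow> 'r" +
  fixes e :: nat and g :: "nat \<Rightarrow> 'r"
  assumes degree_eq: "d = p ^ e"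
    and degree_ge: "2 \<le> d"
    and coeff_in: "k \<in> {1..d-1} \<Longrightarrow> g k \<in> A"
begin

definition poly_map :: "'r \<Rightarrow> 'r" where
  "poly_map z = z ^ d + (\<Sum>k=1..d-1. of_nat p * g k * elem_sym d x (d - k) * z ^ k) + x 0"

lemma critical_point_in_filt: "i \<in> {1..d-1} \<Longrightarrow> x i \<in> filt (Suc 1)"
  using generator_in_filt[of i] by auto

lemma constant_term_in_filt: "x 0 \<in> filt (Suc d)"
  using generator_in_filt[of 0] degree_ge by auto

lemma elem_sym_in_filt: "elem_sym d x j \<in> filt (Suc j)"
  unfolding elem_sym_def
proof (rule filt_sum)
  fix X assume X: "X \<in> {X. X \<subseteq> {1..d-1} \<and> card X = j}"
  then have "finite X" by (auto intro: finite_subset)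
  then have "prod x X \<in> filt (Suc (\<Sum>i\<in>X. 1))"
    using X by (intro filt_prod critical_point_in_filt) auto
  with X show "prod x X \<in> filt (Suc j)" by simp
qed

text \<open>
  All middle coefficients are divisible by \<open>p\<close>, so on leading forms the map is \<open>z \<mapsto> z ^ d + x 0\<close>.
  The hypothesis \<open>1 \<le> M\<close> ensures that the middle terms have weight at most \<open>d * M\<close>.
\<close>

lemma poly_map_diff:
  assumes z: "z \<in> filt (Suc M)" and "1 \<le> M"
  shows "poly_map z - (z ^ d + x 0) \<in> negligible (d * M)"
proof -
  have "(\<Sum>k=1..d-1. of_nat p * g k * elem_sym d x (d - k) * z ^ k) \<in> negligible (d * M)"
  proof (rule negligible_sum)
    fix k assume k: "k \<in> {1..d-1}"
    have "elem_sym d x (d - k) * z ^ k \<in> filt (Suc ((d - k) + k * M))"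
      by (intro filt_mult_Suc elem_sym_in_filt filt_power z)
    moreover have "(d - k) + k * M \<le> d * M"
    proof -
      have "(d - k) * 1 + k * M \<le> (d - k) * M + k * M"
        using assms(2) by (intro add_right_mono mult_le_mono2)
      also have "\<dots> = (d - k + k) * M" by (rule add_mult_distrib[symmetric])
      also have "d - k + k = d" using k by auto
      finally show ?thesis by simp
    qed
    ultimately have "elem_sym d x (d - k) * z ^ k \<in> filt (Suc (d * M))"
      by (auto elim: filt_mono)
    then have "of_nat p * (g k * (elem_sym d x (d - k) * z ^ k)) \<in> negligible (d * M)"
      by (rule p_in_negligible[OF filt_scale]) (rule coeff_in[OF k])
    then show "of_nat p * g k * elem_sym d x (d - k) * z ^ k \<in> negligible (d * M)"
      by (simp add: mult.assoc)
  qed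
  then show ?thesis by (simp add: poly_map_def)
qed

lemma poly_map_in_filt:
  assumes z: "z \<in> filt (Suc M)" and "1 \<le> M"
  shows "poly_map z \<in> filt (Suc (d * M))"
proof -
  have "x 0 \<in> filt (Suc (d * M))"
    by (rule filt_mono[OF constant_term_in_filt]) (use assms in simp)
  then have "(poly_map z - (z ^ d + x 0)) + (z ^ d + x 0) \<in> filt (Suc (d * M))"
    by (intro filt_add negligible_imp_filt[OF poly_map_diff] filt_power assms)
  then show ?thesis by simp
qed

lemma iterate_in_filt:
  assumes "z \<in> filt (Suc 1)"
  shows "(poly_map ^^ n) z \<in> filt (Suc (d ^ n))"
proof (induction n)
  case (Suc n)
  have "1 \<le> d ^ n" using degree_ge by simp
  with Suc show ?case using poly_map_in_filt by simp
qed (use assms in simp)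

text \<open>
  The constant \<open>x 0\<close> enters the leading form only in the first step. There it has the same weight
  \<open>d\<close> as \<open>x i ^ d\<close>; in every later step forms of weight at least \<open>d * d\<close> are compared, and adding
  \<open>x 0\<close> is a lower order change.
\<close>

lemma iterate_diff:
  assumes i: "i \<in> {1..d-1}"
  shows "(poly_map ^^ Suc n) (x i) - (x i ^ d + x 0) ^ (d ^ n) \<in> negligible (d ^ Suc n)"
proof (induction n)
  case 0
  show ?case using poly_map_diff[OF critical_point_in_filt[OF i]] by simp
next
  case (Suc n)
  define y where "y = (poly_map ^^ Suc n) (x i)"
  define u where "u = (x i ^ d + x 0) ^ (d ^ n)"
  have M: "1 \<le> d ^ Suc n" using degree_ge by simp
  have y: "y \<in> filt (Suc (d ^ Suc n))"
    unfolding y_def by (rule iterate_in_filt[OF critical_point_in_filt[OF i]])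
  have "x i ^ d + x 0 \<in> filt (Suc d)"
    using filt_power[OF critical_point_in_filt[OF i], of d] constant_term_in_filt by auto
  then have u: "u \<in> filt (Suc (d ^ Suc n))"
    unfolding u_def using filt_power[of _ d "d ^ n"] by (simp add: mult.commute)
  have "d + 1 \<le> d * 2" using degree_ge by simp
  also have "\<dots> \<le> d * d ^ Suc n"
    using degree_ge self_le_power[of d "Suc n"] by (intro mult_le_mono2) linarith
  finally have "x 0 \<in> negligible (d * d ^ Suc n)"
    by (intro filt_in_negligible filt_mono[OF constant_term_in_filt]) simp
  moreover have "poly_map y - (y ^ d + x 0) \<in> negligible (d * d ^ Suc n)"
    by (rule poly_map_diff[OF y M])
  moreover have "y ^ d - u ^ d \<in> negligible (d * d ^ Suc n)"
    by (rule negligible_power_diff[OF y u]) (use Suc in \<open>simp add: y_def u_def\<close>)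
  ultimately have "(poly_map y - (y ^ d + x 0)) + (y ^ d - u ^ d) + x 0 \<in> negligible (d * d ^ Suc n)"
    by (intro negligible_add)
  moreover have "u ^ d = (x i ^ d + x 0) ^ (d ^ Suc n)"
    by (simp add: u_def power_mult[symmetric] mult.commute)
  ultimately show ?case by (simp add: y_def)
qed

text \<open>
  In an orbit relation the earlier iterate has smaller weight, so the leading form of the later
  one must vanish.
\<close>

lemma preperiodic_relation:
  assumes i: "i \<in> {1..d-1}" and "m < n"
    and eq: "(poly_map ^^ m) (x i) = (poly_map ^^ n) (x i)"
  shows "(x i ^ d + x 0) ^ (d ^ (n - 1)) \<in> negligible (d ^ n)"
proof -
  obtain l where n: "n = Suc l" using assms(2) by (cases n) auto
  have "d ^ m < d ^ n" using assms(2) degree_ge by (intro power_strict_increasing) auto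
  then have "(poly_map ^^ n) (x i) \<in> negligible (d ^ n)"
    unfolding eq[symmetric]
    by (intro filt_in_negligible filt_mono[OF iterate_in_filt[OF critical_point_in_filt[OF i]]]) simp
  from negligible_diff[OF this iterate_diff[OF i, of l, folded n]] show ?thesis
    by (simp add: n)
qed

text \<open>
  In characteristic \<open>p\<close> the vanishing leading forms say \<open>x i ^ d = - x 0\<close> for all \<open>i\<close>, up to
  nilpotents. As \<open>d\<close> is a power of \<open>p\<close>, this makes all \<open>x i\<close> equal; their sum is zero, and their number
  \<open>d - 1\<close> is \<open>-1\<close> modulo \<open>p\<close>, so they vanish, and \<open>x 0\<close> with them. The common exponent
  \<open>q\<close> below is large enough to serve all orbit relations at once, and it is a power of \<open>p\<close> so
  that Frobenius applies.
\<close>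

lemma generator_powers_negligible:
  assumes mn: "\<And>i. i \<in> {1..d-1} \<Longrightarrow> m i < n i"
    and eq: "\<And>i. i \<in> {1..d-1} \<Longrightarrow> (poly_map ^^ m i) (x i) = (poly_map ^^ n i) (x i)"
    and sum_zero: "(\<Sum>i=1..d-1. x i) = 0"
  obtains q where "x 0 ^ q \<in> negligible (d * q)"
    and "\<And>i. i \<in> {1..d-1} \<Longrightarrow> x i ^ (d * q) \<in> negligible (d * q)"
proof -
  define L where "L = (\<Sum>i=1..d-1. n i)"
  define q where "q = d ^ L"
  have q: "q = p ^ (e * L)" "d * q = p ^ (e * Suc L)"
    by (simp_all add: q_def degree_eq power_mult power_add)
  \<comment> \<open>The Frobenius form of the equation \<open>x i ^ d = - x 0\<close>.\<close>
  have rel: "x i ^ (d * q) + x 0 ^ q \<in> negligible (d * q)" if i: "i \<in> {1..d-1}" for i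
  proof -
    have "n i \<le> L" unfolding L_def by (rule member_le_sum) (use i in auto)
    then obtain r where r: "L = (n i - 1) + r" by (metis le_add_diff_inverse diff_le_self le_trans)
    have "d ^ r > 0" using degree_ge by simp
    from negligible_power[OF preperiodic_relation[OF i mn[OF i] eq[OF i]] this]
    have "(x i ^ d + x 0) ^ q \<in> negligible (d ^ (r + n i))"
      by (simp add: q_def r power_mult[symmetric] power_add[symmetric])
    also have "r + n i = Suc L" using r mn[OF i] by simp
    finally have power: "(x i ^ d + x 0) ^ q \<in> negligible (d * q)" by (simp add: q_def)
    have "(x i ^ d + x 0) ^ q - ((x i ^ d) ^ q + x 0 ^ q) \<in> negligible (q * d)"
      unfolding q(1)
      by (rule frobenius_add)
        (use filt_power[OF critical_point_in_filt[OF i], of d] constant_term_in_filt in auto)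
    then have "(x i ^ d + x 0) ^ q - ((x i ^ d) ^ q + x 0 ^ q) \<in> negligible (d * q)"
      by (simp only: mult.commute)
    from negligible_diff[OF power this] have "(x i ^ d) ^ q + x 0 ^ q \<in> negligible (d * q)" by simp
    then show ?thesis by (simp add: power_mult)
  qed
  \<comment> \<open>Summing over all critical points and using that they are centered leaves \<open>(d - 1) * x 0 ^ q\<close>.\<close>
  have "(\<Sum>i=1..d-1. x i) ^ (d * q) - (\<Sum>i=1..d-1. x i ^ (d * q)) \<in> negligible (d * q * 1)"
    unfolding q(2) by (intro frobenius_sum critical_point_in_filt) auto
  moreover have "d * q \<noteq> 0" using degree_ge by (simp add: q_def)
  ultimately have "- (\<Sum>i=1..d-1. x i ^ (d * q)) \<in> negligible (d * q)"
    unfolding sum_zero by (simp add: power_0_left)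
  moreover have "(\<Sum>i=1..d-1. x i ^ (d * q) + x 0 ^ q) \<in> negligible (d * q)"
    by (intro negligible_sum rel)
  ultimately have "(\<Sum>i=1..d-1. x i ^ (d * q) + x 0 ^ q) + - (\<Sum>i=1..d-1. x i ^ (d * q)) \<in> negligible (d * q)"
    by (intro negligible_add)
  then have "of_nat (d - 1) * x 0 ^ q \<in> negligible (d * q)"
    by (simp add: sum.distrib)
  moreover have "of_nat d * x 0 ^ q \<in> negligible (d * q)"
  proof -
    obtain f where f: "d = p * f"
      using degree_eq degree_ge by (cases e) auto
    have "x 0 ^ q \<in> filt (Suc (d * q))"
      using filt_power[OF constant_term_in_filt, of q] by (simp add: mult.commute)
    then have "of_nat p * (of_nat f * x 0 ^ q) \<in> negligible (d * q)"
      by (intro p_in_negligible filt_scale[OF _ of_nat_in])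
    then show ?thesis by (subst f) (simp add: mult.assoc)
  qed
  ultimately have "of_nat d * x 0 ^ q - of_nat (d - 1) * x 0 ^ q \<in> negligible (d * q)"
    by (intro negligible_diff)
  then have b: "x 0 ^ q \<in> negligible (d * q)"
    using degree_ge by (simp add: of_nat_diff algebra_simps)
  moreover have "x i ^ (d * q) \<in> negligible (d * q)" if "i \<in> {1..d-1}" for i
    using negligible_diff[OF rel[OF that] b] by simp
  ultimately show thesis by (rule that)
qed

lemma finitely_generated:
  assumes "\<And>i. i \<in> {1..d-1} \<Longrightarrow> m i < n i"
    and "\<And>i. i \<in> {1..d-1} \<Longrightarrow> (poly_map ^^ m i) (x i) = (poly_map ^^ n i) (x i)"
    and "(\<Sum>i=1..d-1. x i) = 0"
  shows "\<exists>N0. \<forall>N. filt N \<subseteq> filt N0"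
proof -
  obtain q where q: "x 0 ^ q \<in> negligible (d * q)"
    "\<And>i. i \<in> {1..d-1} \<Longrightarrow> x i ^ (d * q) \<in> negligible (d * q)"
    using generator_powers_negligible[of m n] assms by blast
  define K where "K = (\<lambda>i :: nat. if i = 0 then q else d * q)"
  have "x i ^ K i \<in> negligible ((if i = 0 then d else 1) * K i)" if "i \<in> {..<d}" for i
    using that q(1) q(2)[of i] by (auto simp: K_def)
  then show ?thesis using filt_stable[of K] by blast
qed

end

section \<open>Functions with finitely generated powers take finitely many values\<close>

text \<open>
  Infinitely many powers in a finite dimensional space satisfy a nontrivial linear relation, which is
  a nonzero polynomial vanishing at every value of \<open>f\<close>.
\<close>

lemma finite_range_if_powers_span_finite:
  fixes f :: "'v \<Rightarrow> 'a::field"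
  assumes B: "finite B"
    and powers: "\<And>k. \<exists>c. \<forall>v. f v ^ k = (\<Sum>b\<in>B. c b * b v)"
  shows "finite (range f)"
proof -
  define scale :: "'a \<Rightarrow> ('v \<Rightarrow> 'a) \<Rightarrow> 'v \<Rightarrow> 'a" where "scale = (\<lambda>c h v. c * h v)"
  interpret vector_space scale
    by standard (auto simp: scale_def fun_eq_iff algebra_simps)
  have sum_apply: "(\<Sum>b\<in>S. scale (c b) b) v = (\<Sum>b\<in>S. c b * b v)" for S c v
    by (induction S rule: infinite_finite_induct) (auto simp: scale_def)
  define P where "P k = (\<lambda>v. f v ^ k)" for k :: nat
  have finite_roots: ?thesis if "Q \<noteq> 0" "\<And>v. poly Q (f v) = 0" for Q
    by (rule finite_subset[OF _ poly_roots_finite[OF that(1)]]) (use that(2) in auto)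
  show ?thesis
  proof (cases "inj P")
    case False
    then obtain i j where ij: "P i = P j" "i \<noteq> j" unfolding inj_def by blast
    show ?thesis
    proof (rule finite_roots)
      have "coeff (monom 1 i - monom 1 j :: 'a poly) i = 1" using ij by simp
      then show "monom 1 i - monom 1 j \<noteq> (0 :: 'a poly)" by (metis coeff_0 zero_neq_one)
      show "poly (monom 1 i - monom 1 j) (f v) = 0" for v
        using fun_cong[OF ij(1), of v] by (simp add: poly_monom P_def)
    qed
  next
    case True
    have "range P \<subseteq> span B"
    proof safe
      fix k
      obtain c where "\<forall>v. f v ^ k = (\<Sum>b\<in>B. c b * b v)" using powers by blast
      then have "P k = (\<Sum>b\<in>B. scale (c b) b)"
        by (simp add: P_def fun_eq_iff sum_apply)
      then show "P k \<in> span B" by (simp only:) (intro span_sum span_scale span_base)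
    qed
    moreover have "infinite (range P)" using True by (simp add: finite_image_iff)
    ultimately have "dependent (range P)" using independent_span_bound[OF B] by blast
    then obtain S u h where S: "finite S" "S \<subseteq> range P" "h \<in> S" "u h \<noteq> 0"
      and rel: "(\<Sum>b\<in>S. scale (u b) b) = 0"
      unfolding dependent_explicit by blast
    define T where "T = {k. P k \<in> S}"
    have T: "finite T" "bij_betw P T S"
      unfolding T_def using S True
      by (auto intro: finite_vimageI[OF S(1) True, unfolded vimage_def]
          simp: bij_betw_def inj_on_def inj_def)
    define Q where "Q = (\<Sum>k\<in>T. monom (u (P k)) k)"
    show ?thesis
    proof (rule finite_roots)
      obtain k where k: "h = P k" "k \<in> T" using S unfolding T_def by blast
      have "coeff Q k = u h"
        unfolding Q_def using k T(1) by (simp add: coeff_sum)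
      then show "Q \<noteq> 0" using S by auto
      fix v
      have "poly Q (f v) = (\<Sum>k\<in>T. u (P k) * P k v)"
        by (simp add: Q_def poly_sum poly_monom P_def)
      also have "\<dots> = (\<Sum>b\<in>S. u b * b v)"
        using T(2) by (rule sum.reindex_bij_betw)
      also have "\<dots> = 0" using fun_cong[OF rel, of v] by (simp add: sum_apply)
      finally show "poly Q (f v) = 0" .
    qed
  qed
qed

section \<open>The \<open>p\<close>-integral rational numbers in a field of characteristic zero\<close>

definition localized_int :: "nat \<Rightarrow> 'a::field_char_0 set" where
  "localized_int p = {c. \<exists>m s :: int. \<not> int p dvd s \<and> of_int s * c = of_int m}"

lemma localized_intI: "\<not> int p dvd s \<Longrightarrow> of_int s * c = of_int m \<Longrightarrow> c \<in> localized_int p"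
  unfolding localized_int_def by blast

lemma localized_int_mult:
  assumes "prime p" "a \<in> localized_int p" "b \<in> localized_int p"
  shows "a * b \<in> localized_int p"
proof -
  obtain m s m' s' :: int where *: "\<not> int p dvd s" "of_int s * a = of_int m"
      "\<not> int p dvd s'" "of_int s' * b = of_int m'"
    using assms unfolding localized_int_def by blast
  have "of_int (s * s') * (a * b) = (of_int s * a) * (of_int s' * b)" by simp
  also have "\<dots> = of_int (m * m')" using * by simp
  finally have "of_int (s * s') * (a * b) = of_int (m * m')" .
  moreover have "\<not> int p dvd s * s'" using * assms(1) by (simp add: prime_dvd_mult_iff)
  ultimately show ?thesis by (intro localized_intI)
qed

lemma localized_int_add:
  assumes "prime p" "a \<in> localized_int p" "b \<in> localized_int p"
  shows "a + b \<in> localized_int p"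
proof -
  obtain m s m' s' :: int where *: "\<not> int p dvd s" "of_int s * a = of_int m"
      "\<not> int p dvd s'" "of_int s' * b = of_int m'"
    using assms unfolding localized_int_def by blast
  have "of_int (s * s') * (a + b) = of_int s' * (of_int s * a) + of_int s * (of_int s' * b)"
    by (simp add: algebra_simps)
  also have "\<dots> = of_int (s' * m + s * m')" using * by simp
  finally have "of_int (s * s') * (a + b) = of_int (s' * m + s * m')" .
  moreover have "\<not> int p dvd s * s'" using * assms(1) by (simp add: prime_dvd_mult_iff)
  ultimately show ?thesis by (intro localized_intI)
qed

lemma of_int_in_localized_int: "prime p \<Longrightarrow> of_int m \<in> localized_int p"
  by (rule localized_intI[of p 1]) (auto dest: prime_gt_1_nat)

text \<open>
  If \<open>c = m / s\<close> with \<open>s\<close> prime to \<open>p\<close>, then \<open>1 - p * c = (s - p * m) / s\<close>, and \<open>s - p * m\<close> is again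
  prime to \<open>p\<close>.
\<close>

lemma localized_int_unit:
  assumes "c \<in> localized_int p"
  shows "\<exists>u\<in>localized_int p. u * (1 - of_nat p * c) = 1"
proof -
  obtain m s :: int where *: "\<not> int p dvd s" "of_int s * c = of_int m"
    using assms unfolding localized_int_def by blast
  define t where "t = s - int p * m"
  have t: "\<not> int p dvd t" using *(1) by (simp add: t_def dvd_diff_left_iff)
  then have "t \<noteq> 0" by auto
  have "of_int s * (1 - of_nat p * c) = of_int t"
    using *(2) by (simp add: t_def algebra_simps)
  then have "of_int s / of_int t * (1 - of_nat p * c) = 1"
    using \<open>t \<noteq> 0\<close> by (simp add: field_simps)
  moreover have "of_int s / of_int t \<in> localized_int p"
    by (rule localized_intI[OF t, of _ s]) (use \<open>t \<noteq> 0\<close> in simp)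
  ultimately show ?thesis by blast
qed

text \<open>
  A positive \<open>k < p ^ e\<close> is divisible by a lower power of \<open>p\<close> than \<open>p ^ e\<close>. This is where the
  prime power degree makes the middle coefficients divisible by \<open>p\<close>.
\<close>

lemma prime_power_quotient_in_localized_int:
  assumes "prime p" "0 < k" "k < p ^ e"
  shows "of_nat (p ^ e) / of_nat k / of_nat p \<in> (localized_int p :: 'a::field_char_0 set)"
proof -
  obtain j n where k: "\<not> p dvd n" "k = n * p ^ j"
    using prime_power_canonical[OF assms(1,2)] by blast
  have "n > 0" "p > 0" using k assms by (auto simp: prime_gt_0_nat)
  then have "p ^ j \<le> k" using k by simp
  then have "j < e" using assms(3) prime_gt_1_nat[OF assms(1)] by (metis le_less_trans power_less_imp_less_exp)
  then obtain l where e: "e = Suc (j + l)" by (metis less_iff_Suc_add)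
  show ?thesis
  proof (rule localized_intI)
    show "\<not> int p dvd int n" using k by simp
    have "of_nat n \<noteq> (0 :: 'a)" "of_nat p \<noteq> (0 :: 'a)"
      using \<open>n > 0\<close> \<open>p > 0\<close> by auto
    then show "of_int (int n) * (of_nat (p ^ e) / of_nat k / of_nat p) = (of_int (int p ^ l) :: 'a)"
      by (simp add: k(2) e power_add)
  qed
qed

lemma coefficient_ring_constants:
  assumes "prime p"
  shows "coefficient_ring ((\<lambda>c (_ :: 'v). c) ` (localized_int p :: 'a::field_char_0 set)) p"
proof
  let ?A = "(\<lambda>c (_ :: 'v). c) ` (localized_int p :: 'a set)"
  show "prime p" by fact
  show "1 \<in> ?A"
    using of_int_in_localized_int[OF assms, of 1] by (auto simp: image_iff fun_eq_iff)
  fix a b assume a: "a \<in> ?A"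
  show "- a \<in> ?A"
    using a localized_int_mult[OF assms of_int_in_localized_int[OF assms, of "-1"]]
    by (force simp: image_iff fun_eq_iff)
  show "\<exists>u\<in>?A. u * (1 - of_nat p * a) = 1"
    using a localized_int_unit[where 'a='a and p=p] by (fastforce simp: image_iff fun_eq_iff)
  assume b: "b \<in> ?A"
  show "a + b \<in> ?A" "a * b \<in> ?A"
    using a b localized_int_add[OF assms] localized_int_mult[OF assms]
    by (force simp: image_iff fun_eq_iff)+
qed

section \<open>Finiteness of the set of parameters\<close>

lemma sum_fun_apply: "(\<Sum>i\<in>S. f i) v = (\<Sum>i\<in>S. f i v)"
  for f :: "'i \<Rightarrow> 'v \<Rightarrow> 'a::comm_monoid_add"
  by (induction S rule: infinite_finite_induct) auto

lemma prod_fun_apply: "(\<Prod>i\<in>S. f i) v = (\<Prod>i\<in>S. f i v)"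
  for f :: "'i \<Rightarrow> 'v \<Rightarrow> 'a::comm_monoid_mult"
  by (induction S rule: infinite_finite_induct) auto

lemma power_fun_apply: "(f ^ k) v = f v ^ k"
  for f :: "'v \<Rightarrow> 'a::comm_semiring_1"
  by (induction k) auto

lemma elem_sym_fun_apply: "elem_sym d x k v = elem_sym d (\<lambda>i. x i v) k"
  by (simp add: elem_sym_def sum_fun_apply prod_fun_apply)

lemma elem_sym_cong: "(\<And>i. i \<in> {1..d-1} \<Longrightarrow> a i = a' i) \<Longrightarrow> elem_sym d a k = elem_sym d a' k"
  unfolding elem_sym_def by (intro sum.cong refl prod.cong) auto

lemma F_map_mean_zero:
  assumes "d \<ge> 2" "tuple_mean d a = 0"
  shows "F_map d a b z =
    z ^ d + (\<Sum>k=1..d-1. (-1) ^ (d - k) * (of_nat d / of_nat k) * elem_sym d a (d - k) * z ^ k) + b"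
  using assms by (simp add: F_map_def power_0_left)

theorem corollary1:
  fixes d :: nat and m n :: "nat \<Rightarrow> nat"
  assumes "d \<ge> 2" and "primepow d"
    and "\<And>i. i \<in> {1..d-1} \<Longrightarrow> m i < n i"
  shows "finite (V_set d m n :: ((nat \<Rightarrow> 'a::field_char_0) \<times> 'a) set)"
proof -
  define V where "V = (V_set d m n :: ((nat \<Rightarrow> 'a) \<times> 'a) set)"
  obtain p e where p: "prime p" and d: "d = p ^ e"
    using assms(2) unfolding primepow_def by blast
  have "p > 0" using p by (simp add: prime_gt_0_nat)
  \<comment> \<open>Total functions on all pairs are used in place of functions on \<open>V\<close>: pairs outside \<open>V\<close> are sent
    to the origin, which satisfies the same equations.\<close>
  define pt where "pt v = (if v \<in> V then v else (\<lambda>_. 0, 0))" for v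
  define x where "x i = (\<lambda>v. if i = 0 then snd (pt v) else fst (pt v) i)" for i
  define A where "A = (\<lambda>c (_ :: (nat \<Rightarrow> 'a) \<times> 'a). c) ` (localized_int p :: 'a set)"
  define g where "g k = (\<lambda>_ :: (nat \<Rightarrow> 'a) \<times> 'a. (-1) ^ (d - k) * (of_nat d / of_nat k / of_nat p) :: 'a)" for k
  have mean: "tuple_mean d (fst (pt v)) = 0" for v
    by (auto simp: pt_def V_def V_set_def tuple_mean_def)
  have orbit: "(F_map d (fst (pt v)) (snd (pt v)) ^^ m i) (fst (pt v) i)
      = (F_map d (fst (pt v)) (snd (pt v)) ^^ n i) (fst (pt v) i)" if "i \<in> {1..d-1}" for v i
  proof (cases "v \<in> V")
    case True
    with that show ?thesis by (auto simp: pt_def V_def V_set_def)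
  next
    case False
    have "F_map d (\<lambda>_. 0) 0 (0 :: 'a) = 0"
      using assms(1) mean[of v] False by (simp add: F_map_mean_zero pt_def power_0_left)
    then have "(F_map d (\<lambda>_. 0) 0 ^^ l) (0 :: 'a) = 0" for l
      by (induction l) auto
    with False show ?thesis by (simp add: pt_def)
  qed
  interpret coefficient_ring A p
    unfolding A_def by (rule coefficient_ring_constants[OF p])
  interpret critical_orbit_system A p d x e g
  proof
    fix k assume k: "k \<in> {1..d-1}"
    then have "k < p ^ e" using assms(1) by (auto simp: d)
    then have "(-1) ^ (d - k) * (of_nat d / of_nat k / of_nat p) \<in> (localized_int p :: 'a set)"
      using localized_int_mult[OF p of_int_in_localized_int[OF p, of "(-1) ^ (d - k)"]
          prime_power_quotient_in_localized_int[OF p, of k e, folded d]] k d by simp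
    then show "g k \<in> A" unfolding A_def g_def by blast
  qed (use d assms(1) in auto)
  have poly_map_apply: "poly_map z v = F_map d (fst (pt v)) (snd (pt v)) (z v)" for z v
  proof -
    have "elem_sym d (\<lambda>i. x i v) k = elem_sym d (fst (pt v)) k" for k
      by (rule elem_sym_cong) (auto simp: x_def)
    moreover have "x 0 v = snd (pt v)" by (simp add: x_def)
    ultimately show ?thesis
      using \<open>p > 0\<close> by (simp add: poly_map_def F_map_mean_zero[OF assms(1) mean] power_fun_apply
        sum_fun_apply elem_sym_fun_apply g_def)
  qed
  have iterate_apply: "(poly_map ^^ l) z v = (F_map d (fst (pt v)) (snd (pt v)) ^^ l) (z v)" for l z v
    by (induction l) (simp_all add: poly_map_apply)
  have "(\<Sum>i=1..d-1. x i) v = 0" for v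
  proof -
    have "(\<Sum>i=1..d-1. x i) v = (\<Sum>i=1..d-1. fst (pt v) i)"
      unfolding sum_fun_apply by (rule sum.cong) (auto simp: x_def)
    also have "\<dots> = 0" using mean[of v] assms(1) by (simp add: tuple_mean_def)
    finally show ?thesis .
  qed
  then have sum_zero: "(\<Sum>i=1..d-1. x i) = 0" by (simp add: fun_eq_iff)
  have "(poly_map ^^ m i) (x i) = (poly_map ^^ n i) (x i)" if "i \<in> {1..d-1}" for i
  proof
    fix v
    have "x i v = fst (pt v) i" using that by (auto simp: x_def)
    then show "(poly_map ^^ m i) (x i) v = (poly_map ^^ n i) (x i) v"
      using orbit[OF that, of v] by (simp add: iterate_apply)
  qed
  then obtain N0 where N0: "\<And>N. filt N \<subseteq> filt N0"
    using finitely_generated[of m n] assms(3) sum_zero by blast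
  have finite_values: "finite (range (x i))" if "i < d" for i
  proof (rule finite_range_if_powers_span_finite)
    show "finite (monomials 0 N0)" by (rule finite_monomials)
    fix k
    have "x i ^ k \<in> filt N0"
      using filt_power[OF generator_in_filt, of i k] that N0 by blast
    then obtain c z where c: "\<forall>u\<in>monomials 0 N0. c u \<in> A" "z \<in> filt 0"
      "x i ^ k = (\<Sum>u\<in>monomials 0 N0. c u * u) + z"
      using filt_decompose[of _ N0 0] by blast
    have "z = 0" using c(2) by (cases rule: filt.cases) auto
    have "\<forall>u\<in>monomials 0 N0. \<exists>a. c u = (\<lambda>_. a)"
      using c(1) unfolding A_def by blast
    then obtain h where h: "\<And>u. u \<in> monomials 0 N0 \<Longrightarrow> c u = (\<lambda>_. h u)"
      by metis
    have "x i v ^ k = (\<Sum>u\<in>monomials 0 N0. h u * u v)" for v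
    proof -
      have "x i v ^ k = (\<Sum>u\<in>monomials 0 N0. c u v * u v)"
        using fun_cong[OF c(3), of v] \<open>z = 0\<close> by (simp add: power_fun_apply sum_fun_apply)
      also have "\<dots> = (\<Sum>u\<in>monomials 0 N0. h u * u v)"
        by (rule sum.cong) (simp_all add: h)
      finally show ?thesis .
    qed
    then show "\<exists>c. \<forall>v. x i v ^ k = (\<Sum>u\<in>monomials 0 N0. c u * u v)"
      by blast
  qed
  have "V \<subseteq> (\<Pi>\<^sub>E i\<in>{1..d-1}. range (x i)) \<times> range (x 0)"
  proof
    fix v assume v: "v \<in> V"
    obtain a b where ab: "v = (a, b)" by force
    have "a i = x i v" if "i \<in> {1..d-1}" for i
      using that v by (auto simp: x_def pt_def ab)
    moreover have "b = x 0 v" using v by (simp add: x_def pt_def ab)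
    moreover have "a \<in> {1..d-1} \<rightarrow>\<^sub>E UNIV" using v by (auto simp: V_def V_set_def ab)
    ultimately show "v \<in> (\<Pi>\<^sub>E i\<in>{1..d-1}. range (x i)) \<times> range (x 0)"
      unfolding ab by (auto simp: PiE_iff)
  qed
  moreover have "finite ((\<Pi>\<^sub>E i\<in>{1..d-1}. range (x i)) \<times> range (x 0))"
    using assms(1) by (intro finite_cartesian_product finite_PiE finite_values) auto
  ultimately show ?thesis unfolding V_def by (rule finite_subset)
qed

end
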